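(* Consider an $(\mathsf M,n)$ WPIR scheme that satisfies, for all $l\in[n]$ and some positive $\alpha\in\mathbb N$, $$|\mathcal Q_l|\le\alpha<\infty,\qquad |\mathcal A_l|\le|\mathcal X|^\beta,$$ and with maximal leakage $\rho^{(\mathsf{MaxL})}\le\rho$. Then the maximum possible WPIR rate, denoted by $\mathsf R^{(\mathsf{MaxL})}_{\max}$, is bounded from above by $$\mathsf R^{(\mathsf{MaxL})}_{\max}\le\left[1+\sum_{m=1}^{\mathsf M-1}\frac1{n^m}-\sum_{m=1}^{\mathsf M-1}\frac{2^\rho-1}{n^{m-1}}\right]^{-1}.$$
   Context: Notation: $[a]=\{1,\dots,a\}$. $n$ noncolluding servers each store the same $\mathsf M$ independent files $X^{(1)},\dots,X^{(\mathsf M)}$, each uniform on $\mathcal X^\beta$ ($\beta$ is the file size, $\mathcal X$ the file symbol alphabet). The requested index $M$ is uniform on $[\mathsf M]$. An $(\mathsf M,n)$ IR (information retrieval) scheme $\mathscr C$ consists of: a random strategy $S$; queries $Q_l=\phi_l(M,S)$ with alphabet $\mathcal Q_l$ sent to server $l\in[n]$; answer-length functions $\ell_l:\mathcal Q_l\to\{0,1,\dots\}$; answers $A_l=\varphi_l(Q_l,X^{(1)},\dots,X^{(\mathsf M)})\in\mathcal A^{\ell_l(Q_l)}$; such that $H(X^{(M)}\mid A_1,\dots,A_n,Q_1,\dots,Q_n,M)=0$. The queries are assumed independent of the files: $I(X^{(1)},\dots,X^{(\mathsf M)};Q_1,\dots,Q_n)=0$. $\mathcal A_l$ denotes the alphabet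 of the answer $A_l$. A weakly-private information retrieval (WPIR) scheme is an IR scheme in which perfect privacy (i.e. independence of $M$ and $Q_l$ for every $l$) is not required to hold, so that some information on $M$ may leak to the servers. Rate: $\mathsf R(\mathscr C)=\beta\log_2|\mathcal X|/\mathsf D(\mathscr C)$ with $\mathsf D(\mathscr C)=\log_2|\mathcal A|\sum_{l=1}^n\mathbb E[\ell_l(Q_l)]$. Maximal leakage: $\rho^{(\mathsf{MaxL})}(\mathscr C)=\max_{l\in[n]}\log_2\sum_{q\in\mathcal Q_l}\max_{m\in[\mathsf M]}P_{Q_l|M}(q|m)$. Convention for the converse result: the file size $\beta$ is allowed to go to infinity (with $\alpha$ the bound on the query alphabet sizes).
   Formalization: The bracket is assumed positive (otherwise the bound is undefined or negative and false), and the files are assumed independent of the queries jointly with the requested index M, since with M depending on the files the bound fails. *)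

theory Defs
  imports "HOL-Probability.Probability"
begin

text \<open>
  All random variables of a scheme live on an arbitrary probability space. Files, the requested
  index and servers are numbered from 1; values of the fields outside the index ranges
  \<open>{1..N}\<close> (files) and \<open>{1..n}\<close> (servers) are irrelevant.
\<close>

record ('w, 's, 'q, 'x, 'a) ir_scheme =
  sample_space     :: "'w measure"
  file_symbols     :: "'x set"
  file_size        :: nat
  stored_file      :: "nat \<Rightarrow> 'w \<Rightarrow> 'x list"
  requested        :: "'w \<Rightarrow> nat"
  strategy_space   :: "'s measure"
  strategy         :: "'w \<Rightarrow> 's"
  query_alphabet   :: "nat \<Rightarrow> 'q set"
  query_fun        :: "nat \<Rightarrow> nat \<Rightarrow> 's \<Rightarrow> 'q"
  answer_symbols   :: "'a set"
  answer_length    :: "nat \<Rightarrow> 'q \<Rightarrow> nat"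
  answer_alphabet  :: "nat \<Rightarrow> 'a list set"
  answer_fun       :: "nat \<Rightarrow> 'q \<Rightarrow> (nat \<Rightarrow> 'x list) \<Rightarrow> 'a list"

definition words :: "'x set \<Rightarrow> nat \<Rightarrow> 'x list set" where
  "words A k = {xs. set xs \<subseteq> A \<and> length xs = k}"

definition file_space :: "('w, 's, 'q, 'x, 'a) ir_scheme \<Rightarrow> 'x list set" where
  "file_space C = words (file_symbols C) (file_size C)"

definition all_files :: "('w, 's, 'q, 'x, 'a) ir_scheme \<Rightarrow> nat \<Rightarrow> 'w \<Rightarrow> nat \<Rightarrow> 'x list" where
  "all_files C N \<omega> = (\<lambda>m\<in>{1..N}. stored_file C m \<omega>)"

definition query :: "('w, 's, 'q, 'x, 'a) ir_scheme \<Rightarrow> nat \<Rightarrow> 'w \<Rightarrow> 'q" where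
  "query C l \<omega> = query_fun C l (requested C \<omega>) (strategy C \<omega>)"

definition all_queries :: "('w, 's, 'q, 'x, 'a) ir_scheme \<Rightarrow> nat \<Rightarrow> 'w \<Rightarrow> nat \<Rightarrow> 'q" where
  "all_queries C n \<omega> = (\<lambda>l\<in>{1..n}. query C l \<omega>)"

definition answer :: "('w, 's, 'q, 'x, 'a) ir_scheme \<Rightarrow> nat \<Rightarrow> nat \<Rightarrow> 'w \<Rightarrow> 'a list" where
  "answer C N l \<omega> = answer_fun C l (query C l \<omega>) (all_files C N \<omega>)"

definition all_answers ::
    "('w, 's, 'q, 'x, 'a) ir_scheme \<Rightarrow> nat \<Rightarrow> nat \<Rightarrow> 'w \<Rightarrow> nat \<Rightarrow> 'a list" where
  "all_answers C N n \<omega> = (\<lambda>l\<in>{1..n}. answer C N l \<omega>)"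

text \<open>Mutual information and conditional entropy, in bits, of random variables with finite range.\<close>

definition mutual_info :: "'w measure \<Rightarrow> ('w \<Rightarrow> 'u) \<Rightarrow> ('w \<Rightarrow> 'v) \<Rightarrow> real" where
  "mutual_info P U V = prob_space.mutual_information P 2
     (count_space (U ` space P)) (count_space (V ` space P)) U V"

definition cond_entropy :: "'w measure \<Rightarrow> ('w \<Rightarrow> 'u) \<Rightarrow> ('w \<Rightarrow> 'v) \<Rightarrow> real" where
  "cond_entropy P U V = prob_space.conditional_entropy P 2
     (count_space (U ` space P)) (count_space (V ` space P)) U V"

text \<open>
  An information retrieval scheme with \<open>N\<close> files and \<open>n\<close> servers. No privacy requirement is
  imposed, so this is also the notion of a weakly-private scheme.

  The penultimate condition \<open>I(X\<^sup>1,\<dots>,X\<^sup>N ; Q\<^sub>1,\<dots>,Q\<^sub>n, M) = 0\<close> says that the queries are independent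
  of the files, where the user's choice of \<open>M\<close> does not depend on the contents of the files
  either. It follows from independence of \<open>(M,S)\<close> and the files. Without \<open>M\<close> on the query side,
  the choice of \<open>M\<close> itself could inform the user about the files.
\<close>

definition is_ir_scheme :: "nat \<Rightarrow> nat \<Rightarrow> ('w, 's, 'q, 'x, 'a) ir_scheme \<Rightarrow> bool" where
  "is_ir_scheme N n C \<longleftrightarrow>
     prob_space (sample_space C) \<and>
     finite (file_symbols C) \<and>
     finite (answer_symbols C) \<and>
     prob_space.indep_vars (sample_space C) (\<lambda>_. count_space (file_space C)) (stored_file C) {1..N} \<and>
     (\<forall>m\<in>{1..N}. distr (sample_space C) (count_space (file_space C)) (stored_file C m)
                   = uniform_count_measure (file_space C)) \<and>
     requested C \<in> sample_space C \<rightarrow>\<^sub>M count_space {1..N} \<and>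
     distr (sample_space C) (count_space {1..N}) (requested C) = uniform_count_measure {1..N} \<and>
     strategy C \<in> sample_space C \<rightarrow>\<^sub>M strategy_space C \<and>
     (\<forall>l\<in>{1..n}. (\<lambda>(m, s). query_fun C l m s)
        \<in> count_space {1..N} \<Otimes>\<^sub>M strategy_space C \<rightarrow>\<^sub>M count_space (query_alphabet C l)) \<and>
     (\<forall>l\<in>{1..n}. \<forall>q\<in>query_alphabet C l. \<forall>x\<in>{1..N} \<rightarrow>\<^sub>E file_space C.
        answer_fun C l q x
          \<in> answer_alphabet C l \<inter> words (answer_symbols C) (answer_length C l q)) \<and>
     mutual_info (sample_space C) (all_files C N) (\<lambda>\<omega>. (all_queries C n \<omega>, requested C \<omega>)) = 0 \<and>
     cond_entropy (sample_space C) (\<lambda>\<omega>. stored_file C (requested C \<omega>) \<omega>)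
       (\<lambda>\<omega>. (all_answers C N n \<omega>, all_queries C n \<omega>, requested C \<omega>)) = 0"

definition download_cost :: "nat \<Rightarrow> ('w, 's, 'q, 'x, 'a) ir_scheme \<Rightarrow> real" where
  "download_cost n C = log 2 (card (answer_symbols C)) *
     (\<Sum>l=1..n. \<integral>\<omega>. real (answer_length C l (query C l \<omega>)) \<partial>sample_space C)"

definition rate :: "nat \<Rightarrow> ('w, 's, 'q, 'x, 'a) ir_scheme \<Rightarrow> real" where
  "rate n C = real (file_size C) * log 2 (card (file_symbols C)) / download_cost n C"

definition maximal_leakage :: "nat \<Rightarrow> nat \<Rightarrow> ('w, 's, 'q, 'x, 'a) ir_scheme \<Rightarrow> real" where
  "maximal_leakage N n C =
     (MAX l\<in>{1..n}. log 2 (\<Sum>q\<in>query_alphabet C l.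
        MAX m\<in>{1..N}. \<P>(\<omega> in sample_space C. query C l \<omega> = q \<bar> requested C \<omega> = m)))"

text \<open>
  The maximum possible rate under maximal leakage at most \<open>\<rho>\<close>, query alphabets of size at most
  \<open>\<alpha>\<close> and answer alphabets no larger than the file space. The supremum is over schemes of every
  file size and every choice of alphabets; the type argument only records the carrier types. It is
  \<open>-\<infinity>\<close> if there is no such scheme.
\<close>

definition wpir_max_rate ::
    "('w, 's, 'q, 'x, 'a) ir_scheme itself \<Rightarrow> nat \<Rightarrow> nat \<Rightarrow> nat \<Rightarrow> real \<Rightarrow> ereal" where
  "wpir_max_rate _ N n \<alpha> \<rho> =
     (SUP C\<in>{C :: ('w, 's, 'q, 'x, 'a) ir_scheme.
          is_ir_scheme N n C \<and>
          (\<forall>l\<in>{1..n}. finite (query_alphabet C l) \<and> card (query_alphabet C l) \<le> \<alpha>) \<and>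
          (\<forall>l\<in>{1..n}. finite (answer_alphabet C l) \<and>
             card (answer_alphabet C l) \<le> card (file_symbols C) ^ file_size C) \<and>
          maximal_leakage N n C \<le> \<rho>}. ereal (rate n C))"

end

theory Submission
  imports Defs
begin

text \<open>
  This is the Sun--Jafar induction, with the loss caused by imperfect privacy bounded by the leakage.
  Let \<open>L\<close> be the entropy of a file and let \<open>H(A | X\<^sub>S, M = m)\<close> be the uncertainty of all answers given
  the files in \<open>S\<close> when file \<open>m \<notin> S\<close> is requested. Decodability of file \<open>m\<close> splits off \<open>L\<close> and leaves
  \<open>H(A | X\<^sub>S, X\<^sub>m, M = m)\<close>, which is at least the average over the servers of the uncertainties of
  single answers. Such an uncertainty lies between \<open>0\<close> and \<open>L\<close> for every query, so replacing the
  request \<open>m\<close> by a new request \<open>m'\<close> changes its mean by at most \<open>L\<close> times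
  \<open>\<Sum>\<^sub>q (max\<^sub>m P(q | m) - P(q | m)) \<le> 2 powr \<rho> - 1\<close>. By subadditivity the sum over the servers for
  request \<open>m'\<close> is at least \<open>H(A | X\<^sub>S, X\<^sub>m, M = m')\<close>, and the argument repeats. Since the files are
  uniform and independent of the queries, all these entropies are averages over the queries of
  entropies of functions on the finite set of file tuples.
\<close>

subsection \<open>Entropy of functions on a finite set\<close>

definition fibre_card :: "'a set \<Rightarrow> ('a \<Rightarrow> 'b) \<Rightarrow> 'a \<Rightarrow> nat" where
  "fibre_card F f x = card {y \<in> F. f y = f x}"

text \<open>
  The Shannon entropy of \<open>f x\<close> for \<open>x\<close> uniform on \<open>F\<close>: the mean of
  \<open>log (1 / Pr(f = f x))\<close>.
\<close>

definition unif_entropy :: "'a set \<Rightarrow> ('a \<Rightarrow> 'b) \<Rightarrow> real" where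
  "unif_entropy F f = (\<Sum>x\<in>F. log 2 (card F / fibre_card F f x)) / card F"

text \<open>Encoded by the chain rule, so that inequalities between conditional entropies become
  inequalities between joint entropies.\<close>

definition unif_cond_entropy :: "'a set \<Rightarrow> ('a \<Rightarrow> 'b) \<Rightarrow> ('a \<Rightarrow> 'c) \<Rightarrow> real" where
  "unif_cond_entropy F f g = unif_entropy F (\<lambda>x. (f x, g x)) - unif_entropy F g"

section \<open>Fibres and the dependence of entropy on the partition they form\<close>

lemma fibre_card_pos: "finite F \<Longrightarrow> x \<in> F \<Longrightarrow> fibre_card F f x > 0"
  by (auto simp: fibre_card_def card_gt_0_iff)

lemma fibre_card_antimono:
  assumes "finite F" "x \<in> F" "\<And>y. y \<in> F \<Longrightarrow> g y = g x \<Longrightarrow> f y = f x"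
  shows "fibre_card F g x \<le> fibre_card F f x"
  unfolding fibre_card_def using assms(1,2) by (intro card_mono) (auto intro: assms(3))

text \<open>If \<open>g\<close> determines \<open>f\<close>, every fibre of \<open>g\<close> lies in
  a fibre of \<open>f\<close>, so the inequality holds summand by summand.\<close>

lemma unif_entropy_mono:
  assumes "finite F" "\<And>x y. x \<in> F \<Longrightarrow> y \<in> F \<Longrightarrow> g x = g y \<Longrightarrow> f x = f y"
  shows "unif_entropy F f \<le> unif_entropy F g"
  unfolding unif_entropy_def
proof (intro divide_right_mono sum_mono)
  fix x assume x: "x \<in> F"
  have "fibre_card F g x \<le> fibre_card F f x"
    by (rule fibre_card_antimono[OF assms(1) x]) (rule assms(2)[OF _ x])
  moreover have "card F > 0" using x assms(1) by (auto simp: card_gt_0_iff)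
  ultimately show "log 2 (card F / fibre_card F f x) \<le> log 2 (card F / fibre_card F g x)"
    using fibre_card_pos[OF assms(1) x, of f] fibre_card_pos[OF assms(1) x, of g]
    by (intro log_mono) (auto intro!: divide_left_mono)
qed auto

text \<open>Entropy sees only the partition into fibres. Used to drop constant components of tuples
  and to adjoin a decoded file.\<close>

lemma unif_entropy_cong:
  assumes "finite F" "\<And>x y. x \<in> F \<Longrightarrow> y \<in> F \<Longrightarrow> f x = f y \<longleftrightarrow> g x = g y"
  shows "unif_entropy F f = unif_entropy F g"
  by (rule antisym; rule unif_entropy_mono[OF assms(1)]; use assms(2) in blast)

text \<open>Jensen's inequality via \<open>ln r \<le> r - 1\<close>. Applied to likelihood ratios of
  mean at most 1, it yields the two basic entropy bounds below.\<close>

lemma sum_log_le_0: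
  fixes r :: "'a \<Rightarrow> real"
  assumes "finite F" "\<And>x. x \<in> F \<Longrightarrow> r x > 0" "(\<Sum>x\<in>F. r x) \<le> card F"
  shows "(\<Sum>x\<in>F. log 2 (r x)) \<le> 0"
proof -
  have "(\<Sum>x\<in>F. ln (r x)) \<le> (\<Sum>x\<in>F. r x - 1)"
    using assms(2) by (intro sum_mono ln_le_minus_one)
  also have "\<dots> \<le> 0" using assms(3) by (simp add: sum_subtractf)
  finally show ?thesis
    by (simp add: log_def divide_nonpos_pos flip: sum_divide_distrib)
qed

text \<open>A fibre of size s contributes s times 1/s.\<close>

lemma sum_inverse_fibre_card:
  assumes "finite F"
  shows "(\<Sum>x\<in>F. 1 / real (fibre_card F f x)) = card (f ` F)"
proof -
  have "(\<Sum>x\<in>F. 1 / real (fibre_card F f x))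
      = (\<Sum>v\<in>f ` F. \<Sum>x\<in>{x\<in>F. f x = v}. 1 / real (fibre_card F f x))"
    by (rule sum.image_gen[OF assms])
  also have "\<dots> = (\<Sum>v\<in>f ` F. 1)"
  proof (rule sum.cong[OF refl])
    fix v assume v: "v \<in> f ` F"
    have "(\<Sum>x\<in>{x\<in>F. f x = v}. 1 / real (fibre_card F f x))
        = (\<Sum>x\<in>{x\<in>F. f x = v}. 1 / real (card {x\<in>F. f x = v}))"
      by (rule sum.cong) (auto simp: fibre_card_def)
    also have "\<dots> = 1" using v assms by auto
    finally show "(\<Sum>x\<in>{x\<in>F. f x = v}. 1 / real (fibre_card F f x)) = 1" .
  qed
  finally show ?thesis by simp
qed

text \<open>Gibbs' inequality against the uniform law on the image: the ratio of that law to the law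
  of \<open>f\<close> has mean 1 by \<open>sum_inverse_fibre_card\<close>.\<close>

lemma unif_entropy_le_log_card:
  assumes "finite F" "F \<noteq> {}"
  shows "unif_entropy F f \<le> log 2 (card (f ` F))"
proof -
  let ?K = "card (f ` F)"
  have K: "?K > 0" "card F > 0" using assms by (auto simp: card_gt_0_iff)
  note pos = fibre_card_pos[OF assms(1), of _ f]
  have "(\<Sum>x\<in>F. (card F / fibre_card F f x) / ?K) = card F / ?K * (\<Sum>x\<in>F. 1 / real (fibre_card F f x))"
    by (simp add: sum_distrib_left mult.commute)
  also have "\<dots> = card F" using K by (simp add: sum_inverse_fibre_card[OF assms(1)])
  finally have "(\<Sum>x\<in>F. log 2 ((card F / fibre_card F f x) / ?K)) \<le> 0"
    using pos K by (intro sum_log_le_0) (auto simp: assms(1))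
  also have "(\<Sum>x\<in>F. log 2 ((card F / fibre_card F f x) / ?K))
      = (\<Sum>x\<in>F. log 2 (card F / fibre_card F f x) - log 2 ?K)"
    using pos K by (intro sum.cong refl log_divide_pos) auto
  finally show ?thesis using K by (simp add: unif_entropy_def sum_subtractf field_simps)
qed

text \<open>This is nonnegativity of the conditional mutual information of \<open>f\<close> and
  \<open>g\<close> given \<open>c\<close>. The likelihood ratio p(f,c) p(g,c) / (p(f,g,c) p(c)) has
  mean at most 1, which is a matter of counting fibres, and \<open>sum_log_le_0\<close>
  applies.\<close>

lemma unif_entropy_submodular:
  assumes "finite F"
  shows "unif_entropy F (\<lambda>x. (f x, g x, c x)) + unif_entropy F c
    \<le> unif_entropy F (\<lambda>x. (f x, c x)) + unif_entropy F (\<lambda>x. (g x, c x))"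
proof -
  define nfc where "nfc = fibre_card F (\<lambda>x. (f x, c x))"
  define ngc where "ngc = fibre_card F (\<lambda>x. (g x, c x))"
  define nall where "nall = fibre_card F (\<lambda>x. (f x, g x, c x))"
  define nc where "nc = fibre_card F c"
  note defs = nfc_def ngc_def nall_def nc_def
  have pos: "nfc x > 0" "ngc x > 0" "nall x > 0" "nc x > 0" if "x \<in> F" for x
    unfolding defs using fibre_card_pos[OF assms that] by blast+
  \<comment> \<open>The index set is empty or a whole fibre of the triple, so the sum is 0 or
    1.\<close>
  have inner: "(\<Sum>x\<in>{x\<in>F. f x = f y \<and> g x = g z \<and> c x = c y}. 1 / real (nall x)) \<le> 1" for y z
  proof -
    let ?B = "{x\<in>F. f x = f y \<and> g x = g z \<and> c x = c y}"
    have "(\<Sum>x\<in>?B. 1 / real (nall x)) = (\<Sum>x\<in>?B. 1 / real (card ?B))"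
      by (rule sum.cong) (auto simp: nall_def fibre_card_def intro!: arg_cong[of _ _ card])
    also have "\<dots> \<le> 1" by simp
    finally show ?thesis .
  qed
  \<comment> \<open>The numerator counts pairs (y, z). Summing over \<open>x\<close> before
    \<open>y\<close> and \<open>z\<close> lets the fibres of the triple collapse by
    \<open>inner\<close>.\<close>
  have "(\<Sum>x\<in>F. real (nfc x) * ngc x / (nall x * nc x))
      = (\<Sum>x\<in>F. \<Sum>y\<in>F. \<Sum>z\<in>F. if f y = f x \<and> c y = c x \<and> g z = g x \<and> c z = c x
            then 1 / real (nall x) / nc x else 0)"
  proof (rule sum.cong[OF refl])
    fix x assume "x \<in> F"
    have "real (nfc x) * ngc x = (\<Sum>y\<in>F. if f y = f x \<and> c y = c x then 1 else 0)
        * (\<Sum>z\<in>F. if g z = g x \<and> c z = c x then 1 else 0)"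
      using assms by (simp add: nfc_def ngc_def fibre_card_def sum.If_cases Int_def)
    also have "\<dots> = (\<Sum>y\<in>F. \<Sum>z\<in>F. if f y = f x \<and> c y = c x \<and> g z = g x \<and> c z = c x then 1 else 0)"
      unfolding sum_product by (intro sum.cong) auto
    finally show "real (nfc x) * ngc x / (nall x * nc x) = (\<Sum>y\<in>F. \<Sum>z\<in>F.
        if f y = f x \<and> c y = c x \<and> g z = g x \<and> c z = c x then 1 / real (nall x) / nc x else 0)"
      unfolding of_nat_mult by (simp add: sum_divide_distrib if_distrib[of "\<lambda>u. u / _"] cong: if_cong)
  qed
  also have "\<dots> = (\<Sum>y\<in>F. \<Sum>x\<in>F. \<Sum>z\<in>F. if f y = f x \<and> c y = c x \<and> g z = g x \<and> c z = c x
            then 1 / real (nall x) / nc x else 0)"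
    by (rule sum.swap)
  also have "\<dots> = (\<Sum>y\<in>F. \<Sum>z\<in>F. \<Sum>x\<in>F. if f y = f x \<and> c y = c x \<and> g z = g x \<and> c z = c x
            then 1 / real (nall x) / nc x else 0)"
    by (rule sum.cong[OF refl], rule sum.swap)
  also have "\<dots> \<le> (\<Sum>y\<in>F. \<Sum>z\<in>F. if c z = c y then 1 / real (nc y) else 0)"
  proof (intro sum_mono)
    fix y z
    \<comment> \<open>The conditions on \<open>x\<close> force \<open>c z = c y\<close> and allow
      \<open>nc y\<close> in place of \<open>nc x\<close>, which leaves the sum of
      \<open>inner\<close>.\<close>
    have "(\<Sum>x\<in>F. if f y = f x \<and> c y = c x \<and> g z = g x \<and> c z = c x
            then 1 / real (nall x) / nc x else 0)
        = (\<Sum>x\<in>F. if f x = f y \<and> g x = g z \<and> c x = c y \<and> c z = c y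
            then 1 / real (nall x) / nc y else 0)"
      by (intro sum.cong) (auto simp: nc_def fibre_card_def)
    also have "\<dots> = (if c z = c y then
        (\<Sum>x\<in>{x\<in>F. f x = f y \<and> g x = g z \<and> c x = c y}. 1 / real (nall x)) / nc y else 0)"
      using assms by (auto simp: sum_divide_distrib sum.inter_filter intro!: sum.cong)
    also have "\<dots> \<le> (if c z = c y then 1 / real (nc y) else 0)"
      using inner[of y z] by (auto intro: divide_right_mono)
    finally show "(\<Sum>x\<in>F. if f y = f x \<and> c y = c x \<and> g z = g x \<and> c z = c x
            then 1 / real (nall x) / nc x else 0) \<le> (if c z = c y then 1 / real (nc y) else 0)" .
  qed
  also have "\<dots> = (\<Sum>y\<in>F. 1)"
  proof (rule sum.cong[OF refl])
    fix y assume y: "y \<in> F"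
    have "(\<Sum>z\<in>F. if c z = c y then 1 / real (nc y) else 0) = card {z\<in>F. c z = c y} / nc y"
      using assms by (simp flip: sum.inter_filter)
    then show "(\<Sum>z\<in>F. if c z = c y then 1 / real (nc y) else 0) = 1"
      using pos(4)[OF y] by (simp add: nc_def fibre_card_def)
  qed
  finally have "(\<Sum>x\<in>F. log 2 (real (nfc x) * ngc x / (nall x * nc x))) \<le> 0"
    using pos by (intro sum_log_le_0) (auto simp: assms)
  \<comment> \<open>With two fibre sizes above and two below, normalising each by
    \<open>card F\<close> leaves the ratio unchanged.\<close>
  also have "(\<Sum>x\<in>F. log 2 (real (nfc x) * ngc x / (nall x * nc x)))
      = (\<Sum>x\<in>F. log 2 (card F / nall x) + log 2 (card F / nc x)
          - log 2 (card F / nfc x) - log 2 (card F / ngc x))"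
  proof (rule sum.cong[OF refl])
    fix x assume x: "x \<in> F"
    have "card F > 0" using x assms by (auto simp: card_gt_0_iff)
    then show "log 2 (real (nfc x) * ngc x / (nall x * nc x)) = log 2 (card F / nall x)
        + log 2 (card F / nc x) - log 2 (card F / nfc x) - log 2 (card F / ngc x)"
      using pos[OF x] by (simp add: log_divide log_mult)
  qed
  finally have "((\<Sum>x\<in>F. log 2 (card F / nall x)) + (\<Sum>x\<in>F. log 2 (card F / nc x))) / card F
      \<le> ((\<Sum>x\<in>F. log 2 (card F / nfc x)) + (\<Sum>x\<in>F. log 2 (card F / ngc x))) / card F"
    by (intro divide_right_mono) (simp_all add: sum.distrib sum_subtractf)
  then show ?thesis unfolding unif_entropy_def defs by (simp add: add_divide_distrib)
qed

section \<open>Conditional entropy\<close>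

lemma unif_entropy_const:
  assumes "finite F" shows "unif_entropy F (\<lambda>x. a) = 0"
  using assms by (cases "F = {}") (auto simp: unif_entropy_def fibre_card_def)

lemma unif_cond_entropy_nonneg: "finite F \<Longrightarrow> 0 \<le> unif_cond_entropy F f g"
  unfolding unif_cond_entropy_def using unif_entropy_mono[of F "\<lambda>x. (f x, g x)" g] by auto

text \<open>Submodularity with a constant third function is subadditivity.\<close>

lemma unif_cond_entropy_le_unif_entropy:
  assumes "finite F" shows "unif_cond_entropy F f g \<le> unif_entropy F f"
proof -
  have "unif_entropy F (\<lambda>x. (f x, g x, ())) = unif_entropy F (\<lambda>x. (f x, g x))"
    "unif_entropy F (\<lambda>x. (f x, ())) = unif_entropy F f"
    "unif_entropy F (\<lambda>x. (g x, ())) = unif_entropy F g" using assms by (auto intro!: unif_entropy_cong)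
  then show ?thesis
    using unif_entropy_submodular[OF assms, of f g "\<lambda>x. ()"] unif_entropy_const[OF assms, of "()"]
    by (simp add: unif_cond_entropy_def)
qed

lemma unif_cond_entropy_mono:
  assumes "finite F" "\<And>x y. x \<in> F \<Longrightarrow> y \<in> F \<Longrightarrow> h x = h y \<Longrightarrow> f x = f y"
  shows "unif_cond_entropy F f g \<le> unif_cond_entropy F h g"
  unfolding unif_cond_entropy_def
  by (intro diff_right_mono unif_entropy_mono[OF assms(1)]) (auto intro: assms(2))

text \<open>Conditional subadditivity: submodularity given \<open>g\<close> splits off one component
  at a time.\<close>

lemma unif_cond_entropy_tuple_le_sum:
  assumes "finite F" "finite I"
  shows "unif_cond_entropy F (\<lambda>x. \<lambda>l\<in>I. f l x) g \<le> (\<Sum>l\<in>I. unif_cond_entropy F (f l) g)"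
  using assms(2)
proof induction
  case empty
  have "unif_entropy F (\<lambda>x. (\<lambda>l\<in>{}. f l x, g x)) = unif_entropy F g"
    using assms(1) by (intro unif_entropy_cong) auto
  then show ?case by (simp add: unif_cond_entropy_def restrict_def)
next
  case (insert i I)
  \<comment> \<open>The tuple over \<open>insert i I\<close> can be recovered from its component
    \<open>i\<close> and the tuple over \<open>I\<close>, which is the form that submodularity
    expects.\<close>
  have *: "unif_entropy F (\<lambda>x. (\<lambda>l\<in>insert i I. f l x, g x)) \<le> unif_entropy F (\<lambda>x. (f i x, \<lambda>l\<in>I. f l x, g x))"
  proof (rule unif_entropy_mono[OF assms(1)])
    fix x y assume "(f i x, \<lambda>l\<in>I. f l x, g x) = (f i y, \<lambda>l\<in>I. f l y, g y)"
    then have "f i x = f i y" "g x = g y" and eq: "(\<lambda>l\<in>I. f l x) = (\<lambda>l\<in>I. f l y)"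
      by auto
    moreover have "f l x = f l y" if "l \<in> I" for l
      using fun_cong[OF eq, of l] that by simp
    ultimately show "(\<lambda>l\<in>insert i I. f l x, g x) = (\<lambda>l\<in>insert i I. f l y, g y)"
      by (auto intro!: restrict_ext)
  qed
  show ?case
    using * unif_entropy_submodular[OF assms(1), of "f i" "\<lambda>x. \<lambda>l\<in>I. f l x" g] insert.IH
    unfolding unif_cond_entropy_def sum.insert[OF insert.hyps] by linarith
qed

text \<open>A fibre fixes the coordinates in \<open>S\<close> and leaves the others free, so all
  fibres have the same size.\<close>

lemma unif_entropy_restrict:
  assumes "finite I" "finite V" "V \<noteq> {}" "S \<subseteq> I"
  shows "unif_entropy (I \<rightarrow>\<^sub>E V) (\<lambda>x. restrict x S) = card S * log 2 (card V)"
proof -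
  let ?F = "I \<rightarrow>\<^sub>E V" and ?v = "real (card V)"
  have v: "?v > 0" using assms by (auto simp: card_gt_0_iff)
  have cF: "card ?F = card V ^ card I" using assms by (simp add: card_funcsetE)
  have fib: "fibre_card ?F (\<lambda>x. restrict x S) x = card V ^ (card I - card S)" if x: "x \<in> ?F" for x
  proof -
    have "{y \<in> ?F. restrict y S = restrict x S} = (\<Pi>\<^sub>E i\<in>I. if i \<in> S then {x i} else V)" (is "?L = ?R")
    proof (intro equalityI subsetI)
      fix y assume "y \<in> ?L"
      then have y: "y \<in> ?F" and eq: "restrict y S = restrict x S" by auto
      have "y i = x i" if "i \<in> S" for i using fun_cong[OF eq, of i] that by simp
      with y show "y \<in> ?R" by (auto simp: PiE_iff)
    next
      fix y assume "y \<in> ?R"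
      then have y: "\<And>i. i \<in> I \<Longrightarrow> y i \<in> (if i \<in> S then {x i} else V)" "y \<in> extensional I"
        by (auto simp: PiE_iff)
      have "\<And>i. i \<in> S \<Longrightarrow> y i = x i" using y(1) assms(4) by force
      moreover have "y \<in> ?F" using y x by (force simp: PiE_iff split: if_splits)
      ultimately show "y \<in> ?L" by (auto intro!: restrict_ext)
    qed
    moreover have "card ?R = (\<Prod>i\<in>I. if i \<in> S then 1 else card V)"
      using assms(1) by (subst card_PiE) (auto intro!: prod.cong)
    moreover have "\<dots> = (\<Prod>i\<in>I - S. card V)"
      using assms by (intro prod.mono_neutral_cong_right) auto
    moreover have "card (I - S) = card I - card S"
      using assms finite_subset by (intro card_Diff_subset) auto
    ultimately show ?thesis by (simp add: fibre_card_def)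
  qed
  have SI: "card S \<le> card I" using assms card_mono by blast
  have "card ?F / fibre_card ?F (\<lambda>x. restrict x S) x = ?v ^ card S" if "x \<in> ?F" for x
  proof -
    have "?v ^ card I = ?v ^ card S * ?v ^ (card I - card S)" using SI by (simp flip: power_add)
    then show ?thesis using v by (simp add: fib[OF that] cF)
  qed
  moreover have "card ?F > 0" using cF v by simp
  ultimately show ?thesis using v by (simp add: unif_entropy_def log_nat_power)
qed

subsection \<open>The recursion over the requested files\<close>

text \<open>The bracket of the theorem, with \<open>c\<close> for \<open>2 powr \<rho>\<close> and
  \<open>k\<close> for \<open>N - 1\<close>; a variable \<open>k\<close> permits induction on the
  number of remaining files.\<close>

definition leakage_bracket :: "nat \<Rightarrow> real \<Rightarrow> nat \<Rightarrow> real" where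
  "leakage_bracket n c k =
     1 + (\<Sum>m=1..k. 1 / real n ^ m) - (\<Sum>m=1..k. (c - 1) / real n ^ (m - 1))"

lemma leakage_bracket_0: "leakage_bracket n c 0 = 1"
  by (simp add: leakage_bracket_def)

text \<open>The defining sums grow at their last term, whereas the induction on the files adds a
  term in front and divides the rest by \<open>n\<close>; shifting the exponents by one reconciles
  the two.\<close>

lemma leakage_bracket_Suc:
  "leakage_bracket n c (Suc k) = 1 - (c - 1) + leakage_bracket n c k / n"
proof (induction k)
  case 0
  then show ?case by (simp add: leakage_bracket_def)
next
  case (Suc k)
  have step: "leakage_bracket n c (Suc j) = leakage_bracket n c j + 1 / real n ^ Suc j - (c - 1) / real n ^ j"
    for j by (simp add: leakage_bracket_def)
  have "leakage_bracket n c (Suc (Suc k))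
      = 1 - (c - 1) + (leakage_bracket n c k + 1 / real n ^ Suc k - (c - 1) / real n ^ k) / n"
    unfolding step[of "Suc k"] Suc.IH by (simp add: add_divide_distrib diff_divide_distrib mult.commute)
  then show ?case unfolding step[of k] .
qed

text \<open>
  \<open>W m k\<close> is the probability of the query tuple \<open>k\<close> given that file \<open>m\<close> is requested, and \<open>c\<close> bounds
  \<open>2\<close> to the power of the maximal leakage.
\<close>

locale weighted_retrieval =
  fixes N n :: nat and V :: "'v set" and R :: "nat \<Rightarrow> 'q set"
    and W :: "nat \<Rightarrow> (nat \<Rightarrow> 'q) \<Rightarrow> real"
    and \<phi> :: "nat \<Rightarrow> 'q \<Rightarrow> (nat \<Rightarrow> 'v) \<Rightarrow> 'b"
    and c :: real
  assumes n_pos: "n \<ge> 1"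
    and finite_V: "finite V" and V_nonempty: "V \<noteq> {}"
    and finite_R: "\<And>l. l \<in> {1..n} \<Longrightarrow> finite (R l)"
    and W_nonneg: "\<And>m k. W m k \<ge> 0"
    and W_sum: "\<And>m. m \<in> {1..N} \<Longrightarrow> (\<Sum>k\<in>PiE {1..n} R. W m k) = 1"
    and decodable: "\<And>m k x y. m \<in> {1..N} \<Longrightarrow> k \<in> PiE {1..n} R \<Longrightarrow> W m k > 0
      \<Longrightarrow> x \<in> {1..N} \<rightarrow>\<^sub>E V \<Longrightarrow> y \<in> {1..N} \<rightarrow>\<^sub>E V
      \<Longrightarrow> (\<And>l. l \<in> {1..n} \<Longrightarrow> \<phi> l (k l) x = \<phi> l (k l) y) \<Longrightarrow> x m = y m"
    and answers_le: "\<And>l r. l \<in> {1..n} \<Longrightarrow> r \<in> R l \<Longrightarrow> card (\<phi> l r ` ({1..N} \<rightarrow>\<^sub>E V)) \<le> card V"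
    and leakage_le: "\<And>l. l \<in> {1..n} \<Longrightarrow>
      (\<Sum>r\<in>R l. MAX m\<in>{1..N}. \<Sum>k | k \<in> PiE {1..n} R \<and> k l = r. W m k) \<le> c"
begin

abbreviation "F \<equiv> {1..N} \<rightarrow>\<^sub>E V"
abbreviation "K \<equiv> PiE {1..n} R"
abbreviation "L \<equiv> log 2 (card V)"

definition answers :: "(nat \<Rightarrow> 'q) \<Rightarrow> (nat \<Rightarrow> 'v) \<Rightarrow> nat \<Rightarrow> 'b" where
  "answers k x = (\<lambda>l\<in>{1..n}. \<phi> l (k l) x)"

definition marginal :: "nat \<Rightarrow> nat \<Rightarrow> 'q \<Rightarrow> real" where
  "marginal l m r = (\<Sum>k | k \<in> K \<and> k l = r. W m k)"

text \<open>This is H(A | Q, X_S, M = m): averaging over \<open>k\<close> conditions on the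
  queries.\<close>

definition joint_uncertainty :: "nat \<Rightarrow> nat set \<Rightarrow> real" where
  "joint_uncertainty m S = (\<Sum>k\<in>K. W m k * unif_cond_entropy F (answers k) (\<lambda>x. restrict x S))"

text \<open>Averaged over the query of server \<open>l\<close> alone, so that \<open>m\<close>
  enters only through the marginal, which the leakage controls.\<close>

definition server_uncertainty :: "nat \<Rightarrow> nat \<Rightarrow> nat set \<Rightarrow> real" where
  "server_uncertainty l m S = (\<Sum>r\<in>R l. marginal l m r * unif_cond_entropy F (\<phi> l r) (\<lambda>x. restrict x S))"

section \<open>Finiteness, marginals and bounds for single answers\<close>

lemma finite_F: "finite F" and F_nonempty: "F \<noteq> {}"
  using finite_V V_nonempty by (auto intro!: finite_PiE simp: PiE_eq_empty_iff)

lemma finite_K: "finite K"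
  using finite_R by (intro finite_PiE) auto

lemma L_nonneg: "L \<ge> 0"
proof -
  have "card V \<ge> 1" using finite_V V_nonempty by (simp add: Suc_le_eq card_gt_0_iff)
  then show ?thesis by simp
qed

lemma marginal_nonneg: "marginal l m r \<ge> 0"
  unfolding marginal_def by (intro sum_nonneg W_nonneg)

text \<open>Grouping the tuples by their component \<open>l\<close> moves means between tuple
  weights and one-server marginals.\<close>

lemma sum_marginal:
  assumes "l \<in> {1..n}"
  shows "(\<Sum>r\<in>R l. marginal l m r * g r) = (\<Sum>k\<in>K. W m k * g (k l))"
proof -
  have "(\<Sum>r\<in>R l. \<Sum>k | k \<in> K \<and> k l = r. W m k * g (k l)) = (\<Sum>k\<in>K. W m k * g (k l))"
    using assms finite_K finite_R by (intro sum.group) auto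
  moreover have "marginal l m r * g r = (\<Sum>k | k \<in> K \<and> k l = r. W m k * g (k l))" for r
    by (simp add: marginal_def sum_distrib_right)
  ultimately show ?thesis by simp
qed

text \<open>The bound by the number of answer values leads to the download cost; \<open>0\<close>
  and \<open>L\<close> bound the effect of changing the request.\<close>

lemma unif_cond_entropy_answer_bounds:
  assumes "l \<in> {1..n}" "r \<in> R l"
  shows "0 \<le> unif_cond_entropy F (\<phi> l r) g" and "unif_cond_entropy F (\<phi> l r) g \<le> log 2 (card (\<phi> l r ` F))"
    and "unif_cond_entropy F (\<phi> l r) g \<le> L"
proof -
  show "0 \<le> unif_cond_entropy F (\<phi> l r) g" by (rule unif_cond_entropy_nonneg[OF finite_F])
  show *: "unif_cond_entropy F (\<phi> l r) g \<le> log 2 (card (\<phi> l r ` F))"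
    using unif_cond_entropy_le_unif_entropy[OF finite_F] unif_entropy_le_log_card[OF finite_F F_nonempty]
      order_trans by blast
  have "card (\<phi> l r ` F) > 0" using finite_F F_nonempty by (simp add: card_gt_0_iff)
  then have "log 2 (card (\<phi> l r ` F)) \<le> L"
    using answers_le[OF assms] by (intro log_mono) auto
  with * show "unif_cond_entropy F (\<phi> l r) g \<le> L" by linarith
qed

lemma joint_uncertainty_nonneg: "joint_uncertainty m S \<ge> 0"
  unfolding joint_uncertainty_def
  by (intro sum_nonneg mult_nonneg_nonneg W_nonneg unif_cond_entropy_nonneg finite_F)

text \<open>The answers determine file \<open>m\<close>, so adjoining it to the known files leaves
  the joint entropy unchanged, while the entropy of the known files grows by
  \<open>L\<close>.\<close>

lemma unif_cond_entropy_answers_insert: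
  assumes "m \<in> {1..N}" "S \<subseteq> {1..N}" "m \<notin> S" "k \<in> K" "W m k > 0"
  shows "unif_cond_entropy F (answers k) (\<lambda>x. restrict x S)
    = L + unif_cond_entropy F (answers k) (\<lambda>x. restrict x (insert m S))"
proof -
  have "unif_entropy F (\<lambda>x. (answers k x, restrict x S))
      = unif_entropy F (\<lambda>x. (answers k x, restrict x (insert m S)))"
  proof (rule unif_entropy_cong[OF finite_F])
    fix x y assume xy: "x \<in> F" "y \<in> F"
    have dec: "x m = y m" if eq: "answers k x = answers k y"
    proof (rule decodable[OF assms(1,4,5) xy])
      fix l assume "l \<in> {1..n}"
      then show "\<phi> l (k l) x = \<phi> l (k l) y"
        using fun_cong[OF eq, of l] by (simp add: answers_def)
    qed
    have restr: "restrict x A = restrict y A \<longleftrightarrow> (\<forall>i\<in>A. x i = y i)" for A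
      by (metis restrict_apply' restrict_ext)
    show "(answers k x, restrict x S) = (answers k y, restrict y S)
      \<longleftrightarrow> (answers k x, restrict x (insert m S)) = (answers k y, restrict y (insert m S))"
      using dec by (auto simp: restr)
  qed
  moreover have "unif_entropy F (\<lambda>x. restrict x (insert m S)) = L + unif_entropy F (\<lambda>x. restrict x S)"
  proof -
    have "finite S" using assms(2) finite_subset by blast
    then have "card (insert m S) = Suc (card S)" using assms(3) by simp
    then show ?thesis
      using assms(1,2) by (simp add: unif_entropy_restrict finite_V V_nonempty algebra_simps)
  qed
  ultimately show ?thesis by (simp add: unif_cond_entropy_def)
qed

lemma joint_uncertainty_insert:
  assumes "m \<in> {1..N}" "S \<subseteq> {1..N}" "m \<notin> S"
  shows "joint_uncertainty m S = L + joint_uncertainty m (insert m S)"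
proof -
  have "joint_uncertainty m S
      = (\<Sum>k\<in>K. W m k * (L + unif_cond_entropy F (answers k) (\<lambda>x. restrict x (insert m S))))"
    unfolding joint_uncertainty_def
  proof (rule sum.cong[OF refl])
    \<comment> \<open>Decodability is available only for tuples of positive weight; the others
      contribute 0 to both sides.\<close>
    fix k assume k: "k \<in> K"
    show "W m k * unif_cond_entropy F (answers k) (\<lambda>x. restrict x S)
        = W m k * (L + unif_cond_entropy F (answers k) (\<lambda>x. restrict x (insert m S)))"
      using unif_cond_entropy_answers_insert[OF assms k] W_nonneg[of m k] by (cases "W m k = 0") auto
  qed
  also have "\<dots> = (\<Sum>k\<in>K. W m k) * L + joint_uncertainty m (insert m S)"
    by (simp add: joint_uncertainty_def ring_distribs sum.distrib sum_distrib_right)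
  finally show ?thesis unfolding W_sum[OF assms(1)] by simp
qed

text \<open>Subadditivity for each query tuple. The term of server \<open>l\<close> depends on
  \<open>k l\<close> only, so its mean is one over the marginal.\<close>

lemma joint_uncertainty_le_sum: "joint_uncertainty m S \<le> (\<Sum>l=1..n. server_uncertainty l m S)"
proof -
  let ?g = "\<lambda>x. restrict x S"
  have "joint_uncertainty m S \<le> (\<Sum>k\<in>K. W m k * (\<Sum>l=1..n. unif_cond_entropy F (\<phi> l (k l)) ?g))"
    unfolding joint_uncertainty_def answers_def
    by (intro sum_mono mult_left_mono W_nonneg unif_cond_entropy_tuple_le_sum finite_F) simp
  also have "\<dots> = (\<Sum>l=1..n. \<Sum>k\<in>K. W m k * unif_cond_entropy F (\<phi> l (k l)) ?g)"
    unfolding sum_distrib_left by (rule sum.swap)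
  also have "\<dots> = (\<Sum>l=1..n. server_uncertainty l m S)"
    unfolding server_uncertainty_def
    by (intro sum.cong refl sum_marginal[symmetric, of _ m "\<lambda>r. unif_cond_entropy F (\<phi> _ r) ?g"])
  finally show ?thesis .
qed

text \<open>Each single answer is a function of all answers, so each of the \<open>n\<close>
  summands is at most the joint uncertainty.\<close>

lemma sum_le_joint_uncertainty: "(\<Sum>l=1..n. server_uncertainty l m S) \<le> n * joint_uncertainty m S"
proof -
  let ?g = "\<lambda>x. restrict x S"
  have "server_uncertainty l m S \<le> joint_uncertainty m S" if l: "l \<in> {1..n}" for l
  proof -
    have "server_uncertainty l m S = (\<Sum>k\<in>K. W m k * unif_cond_entropy F (\<phi> l (k l)) ?g)"
      unfolding server_uncertainty_def by (rule sum_marginal[OF l])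
    also have "\<dots> \<le> joint_uncertainty m S"
      unfolding joint_uncertainty_def
    proof (intro sum_mono mult_left_mono W_nonneg unif_cond_entropy_mono finite_F)
      fix k x y assume "answers k x = answers k y"
      from fun_cong[OF this, of l] show "\<phi> l (k l) x = \<phi> l (k l) y"
        using l by (simp add: answers_def)
    qed
    finally show ?thesis .
  qed
  then show ?thesis using sum_bounded_above[of "{1..n}" "\<lambda>l. server_uncertainty l m S"] by simp
qed

lemma server_uncertainty_change_index:
  assumes "l \<in> {1..n}" "m \<in> {1..N}" "m' \<in> {1..N}"
  shows "server_uncertainty l m' S \<le> server_uncertainty l m S + L * (c - 1)"
proof -
  let ?h = "\<lambda>r. unif_cond_entropy F (\<phi> l r) (\<lambda>x. restrict x S)"
  let ?M = "\<lambda>r. MAX m\<in>{1..N}. marginal l m r"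
  have M: "marginal l i r \<le> ?M r" if "i \<in> {1..N}" for i r
    using that by (intro Max_ge) auto
  have "server_uncertainty l m' S - server_uncertainty l m S
      = (\<Sum>r\<in>R l. (marginal l m' r - marginal l m r) * ?h r)"
    by (simp add: server_uncertainty_def sum_subtractf ring_distribs)
  also have "\<dots> \<le> (\<Sum>r\<in>R l. (?M r - marginal l m r) * L)"
  proof (rule sum_mono)
    fix r assume r: "r \<in> R l"
    \<comment> \<open>A difference of two marginals may be negative. Passing to the maximum first
      makes the factor nonnegative, and only then can \<open>?h r\<close> be replaced by
      \<open>L\<close>.\<close>
    have "(marginal l m' r - marginal l m r) * ?h r \<le> (?M r - marginal l m r) * ?h r"
      using M[OF assms(3), of r] unif_cond_entropy_answer_bounds(1)[OF assms(1) r] by (intro mult_right_mono) auto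
    also have "\<dots> \<le> (?M r - marginal l m r) * L"
      using M[OF assms(2), of r] unif_cond_entropy_answer_bounds(3)[OF assms(1) r] by (intro mult_left_mono) auto
    finally show "(marginal l m' r - marginal l m r) * ?h r \<le> (?M r - marginal l m r) * L" .
  qed
  also have "\<dots> = ((\<Sum>r\<in>R l. ?M r) - (\<Sum>r\<in>R l. marginal l m r)) * L"
    by (simp only: sum_distrib_right[symmetric] sum_subtractf)
  also have "(\<Sum>r\<in>R l. marginal l m r) = 1"
    using sum_marginal[OF assms(1), of m "\<lambda>_. 1"] W_sum[OF assms(2)] by simp
  also have "((\<Sum>r\<in>R l. ?M r) - 1) * L \<le> (c - 1) * L"
    using leakage_le[OF assms(1)] L_nonneg
    by (intro mult_right_mono diff_right_mono) (simp_all add: marginal_def)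
  finally show ?thesis by (simp add: mult.commute)
qed

text \<open>Induction on \<open>k\<close>, the number of files that remain unknown once file
  \<open>m\<close> is decoded; file \<open>m\<close> itself accounts for the
  \<open>Suc\<close>.\<close>

lemma joint_uncertainty_ge:
  assumes "m \<in> {1..N}" "S \<subseteq> {1..N}" "m \<notin> S" "card ({1..N} - S) = Suc k"
  shows "L * leakage_bracket n c k \<le> joint_uncertainty m S"
  using assms
proof (induction k arbitrary: m S)
  case 0
  then show ?case
    using joint_uncertainty_insert[OF 0(1-3)] joint_uncertainty_nonneg[of m "insert m S"]
    by (simp add: leakage_bracket_0)
next
  case (Suc k)
  let ?S = "insert m S"
  have card: "card ({1..N} - ?S) = Suc k"
    using Suc.prems by (simp add: Diff_insert[of _ m S] card_Diff_singleton)
  \<comment> \<open>A file outside \<open>?S\<close> serves as the next request; the induction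
    hypothesis is applied to it.\<close>
  then obtain m' where m': "m' \<in> {1..N}" "m' \<notin> ?S"
    by (metis DiffE card.empty ex_in_conv nat.distinct(1))
  have "L * leakage_bracket n c k \<le> joint_uncertainty m' ?S"
    using Suc.prems m' card by (intro Suc.IH) auto
  also have "\<dots> \<le> (\<Sum>l=1..n. server_uncertainty l m' ?S)"
    by (rule joint_uncertainty_le_sum)
  also have "\<dots> \<le> (\<Sum>l=1..n. server_uncertainty l m ?S + L * (c - 1))"
    by (intro sum_mono server_uncertainty_change_index Suc.prems m')
  also have "\<dots> \<le> n * joint_uncertainty m ?S + n * (L * (c - 1))"
    using sum_le_joint_uncertainty[of m ?S] by (simp add: sum.distrib)
  finally have "L * leakage_bracket n c k / n \<le> joint_uncertainty m ?S + L * (c - 1)"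
    using n_pos by (simp add: field_simps)
  \<comment> \<open>Adding the \<open>L\<close> split off by decoding file \<open>m\<close> produces
    the recursion of \<open>leakage_bracket_Suc\<close>.\<close>
  then show ?case
    using joint_uncertainty_insert[OF Suc.prems(1-3)]
    by (simp add: leakage_bracket_Suc algebra_simps)
qed

text \<open>The recursion starts with no file known, hence with \<open>N - 1\<close> files besides
  the requested one.\<close>

lemma log_answers_ge:
  assumes "m \<in> {1..N}"
  shows "L * leakage_bracket n c (N - 1)
    \<le> (\<Sum>l=1..n. \<Sum>r\<in>R l. marginal l m r * log 2 (card (\<phi> l r ` F)))"
proof -
  have "L * leakage_bracket n c (N - 1) \<le> joint_uncertainty m {}"
    using assms by (intro joint_uncertainty_ge) auto
  also have "\<dots> \<le> (\<Sum>l=1..n. server_uncertainty l m {})"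
    by (rule joint_uncertainty_le_sum)
  also have "\<dots> \<le> (\<Sum>l=1..n. \<Sum>r\<in>R l. marginal l m r * log 2 (card (\<phi> l r ` F)))"
    unfolding server_uncertainty_def
    by (intro sum_mono mult_left_mono marginal_nonneg unif_cond_entropy_answer_bounds)
  finally show ?thesis .
qed

end

subsection \<open>Vanishing information between simple random variables\<close>

text \<open>Only finitely many values occur, so those of probability 0 can be discarded
  together.\<close>

lemma (in prob_space) AE_fibre_pos:
  assumes "simple_function M X"
  shows "AE \<omega> in M. 0 < prob (X -` {X \<omega>} \<inter> space M)"
proof -
  have "AE \<omega> in M. \<forall>v\<in>X ` space M. prob (X -` {v} \<inter> space M) = 0 \<longrightarrow> X \<omega> \<noteq> v"
  proof (rule AE_finite_allI)
    show "finite (X ` space M)" using assms by (rule simple_functionD)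
    fix v
    have ev: "X -` {v} \<inter> space M \<in> events" using assms by (rule simple_functionD)
    show "AE \<omega> in M. prob (X -` {v} \<inter> space M) = 0 \<longrightarrow> X \<omega> \<noteq> v"
      using prob_eq_0[OF ev] by (cases "prob (X -` {v} \<inter> space M) = 0") (auto elim: AE_mp)
  qed
  then show ?thesis
    by (rule AE_mp) (auto intro!: AE_I2 simp: zero_less_measure_iff measure_eq_0_null_sets emeasure_eq_measure)
qed

text \<open>Mutual information is the divergence of the joint law from the product law. If it
  vanishes the two laws coincide, and evaluating them at a point gives the factorisation.\<close>

lemma (in information_space) prob_mult_of_mutual_information_0:
  assumes X: "simple_function M X" and Y: "simple_function M Y" and "\<I>(X ; Y) = 0"
    and xy: "x \<in> X ` space M" "y \<in> Y ` space M"
  shows "prob {\<omega> \<in> space M. X \<omega> = x \<and> Y \<omega> = y}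
    = prob {\<omega> \<in> space M. X \<omega> = x} * prob {\<omega> \<in> space M. Y \<omega> = y}"
proof -
  let ?S = "count_space (X ` space M)" and ?T = "count_space (Y ` space M)"
  let ?P = "distr M ?S X \<Otimes>\<^sub>M distr M ?T Y" and ?Q = "distr M (?S \<Otimes>\<^sub>M ?T) (\<lambda>\<omega>. (X \<omega>, Y \<omega>))"
  have fin: "finite (X ` space M)" "finite (Y ` space M)"
    using X Y by (auto dest: simple_functionD)
  have rv[measurable]: "X \<in> measurable M ?S" "Y \<in> measurable M ?T"
    using X Y by (auto simp: simple_function_def measurable_count_space_eq2)
  interpret dX: prob_space "distr M ?S X" by (rule prob_space_distr) (rule rv)
  interpret dY: prob_space "distr M ?T Y" by (rule prob_space_distr) (rule rv)
  interpret XY: pair_prob_space "distr M ?S X" "distr M ?T Y" by standard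
  interpret P: information_space ?P b by standard (rule b_gt_1)
  interpret Q: prob_space ?Q by (rule prob_space_distr) simp
  have sets: "sets ?P = sets (?S \<Otimes>\<^sub>M ?T)"
    by (intro sets_pair_measure_cong) simp_all
  have ST: "?S \<Otimes>\<^sub>M ?T = count_space (X ` space M \<times> Y ` space M)"
    using fin by (rule pair_measure_count_space)
  \<comment> \<open>Almost surely \<open>(X \<omega>, Y \<omega>)\<close> is a point whose two
    coordinates have positive probability. Such a point has positive product mass and so lies in no
    null set of the product law.\<close>
  have ac: "absolutely_continuous ?P ?Q"
    unfolding absolutely_continuous_def
  proof
    fix A assume A: "A \<in> null_sets ?P"
    then have A': "A \<in> sets (?S \<Otimes>\<^sub>M ?T)" using sets by auto
    have "AE \<omega> in M. (X \<omega>, Y \<omega>) \<notin> A"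
      using AE_fibre_pos[OF X] AE_fibre_pos[OF Y] AE_space
    proof eventually_elim
      case (elim \<omega>)
      show ?case
      proof
        assume "(X \<omega>, Y \<omega>) \<in> A"
        then have "emeasure ?P ({X \<omega>} \<times> {Y \<omega>}) \<le> emeasure ?P A"
          using A by (intro emeasure_mono) auto
        also have "\<dots> = 0" using A by auto
        finally have "emeasure (distr M ?S X) {X \<omega>} * emeasure (distr M ?T Y) {Y \<omega>} = 0"
          using elim(3) by (subst (asm) dY.emeasure_pair_measure_Times) auto
        then show False
          using elim by (simp add: emeasure_distr emeasure_eq_measure)
      qed
    qed
    then have "emeasure M {\<omega> \<in> space M. (X \<omega>, Y \<omega>) \<in> A} = 0"
      by (intro emeasure_eq_0_AE) simp
    then have "emeasure ?Q A = 0"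
      using A' by (subst emeasure_distr) (simp_all add: vimage_def Int_def conj_commute)
    then show "A \<in> null_sets ?Q" using A' by auto
  qed
  \<comment> \<open>The density lives on a finite space, so it is bounded.\<close>
  have int: "integrable ?Q (entropy_density b ?P ?Q)"
  proof -
    define h where "h = entropy_density b ?P ?Q"
    have finQ: "finite (space ?Q)" using fin by (simp add: space_pair_measure)
    have "AE z in ?Q. norm (h z) \<le> Max ((\<lambda>z. norm (h z)) ` space ?Q)"
      using finQ by (intro AE_I2 Max_ge finite_imageI imageI)
    moreover have "h \<in> borel_measurable ?Q"
    proof -
      have "sets ?Q = sets ?P" using sets by simp
      show ?thesis
        unfolding h_def measurable_cong_sets[OF \<open>sets ?Q = sets ?P\<close> refl]
        by (rule measurable_entropy_density)
    qed
    ultimately show ?thesis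
      unfolding h_def[symmetric] by (rule Q.integrable_const_bound)
  qed
  have "?Q = ?P"
  proof (rule P.KL_eq_0_iff_eq_ac[THEN iffD1])
    show "sets ?Q = sets ?P" using sets by simp
    show "KL_divergence b ?P ?Q = 0" using assms(3) by (simp add: mutual_information_def)
  qed (fact Q.prob_space_axioms ac int)+
  moreover have "emeasure ?P ({x} \<times> {y}) = emeasure (distr M ?S X) {x} * emeasure (distr M ?T Y) {y}"
    using xy by (intro dY.emeasure_pair_measure_Times) auto
  moreover have "emeasure ?Q ({x} \<times> {y}) = emeasure M {\<omega> \<in> space M. X \<omega> = x \<and> Y \<omega> = y}"
  proof -
    have "{x} \<times> {y} \<in> sets (?S \<Otimes>\<^sub>M ?T)" using xy by (intro pair_measureI) auto
    then show ?thesis by (subst emeasure_distr) (auto intro!: arg_cong[of _ _ "emeasure M"])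
  qed
  moreover have "emeasure (distr M ?S X) {x} = emeasure M {\<omega> \<in> space M. X \<omega> = x}"
    "emeasure (distr M ?T Y) {y} = emeasure M {\<omega> \<in> space M. Y \<omega> = y}"
    using xy by (subst emeasure_distr; auto intro!: arg_cong[of _ _ "emeasure M"])+
  ultimately show ?thesis
    by (simp add: emeasure_eq_measure flip: ennreal_mult)
qed

text \<open>Each summand -p(x,y) log (p(x,y) / p(y)) is nonnegative, so all vanish, and p(x,y) > 0
  forces p(x,y) = p(y). Two distinct such values would together exceed p(y).\<close>

lemma (in information_space) determined_of_conditional_entropy_0:
  assumes X: "simple_function M X" and Y: "simple_function M Y" and H0: "\<H>(X | Y) = 0"
    and pos: "prob {\<omega> \<in> space M. X \<omega> = x \<and> Y \<omega> = y} > 0" "prob {\<omega> \<in> space M. X \<omega> = x' \<and> Y \<omega> = y} > 0"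
  shows "x = x'"
proof (rule ccontr)
  assume "x \<noteq> x'"
  define Py where "Py y = prob (Y -` {y} \<inter> space M)" for y
  define Pxy where "Pxy z = prob ((\<lambda>\<omega>. (X \<omega>, Y \<omega>)) -` {z} \<inter> space M)" for z
  note XY = simple_function_Pair[OF X Y]
  have ev: "Y -` {v} \<inter> space M \<in> events" "(\<lambda>\<omega>. (X \<omega>, Y \<omega>)) -` {z} \<inter> space M \<in> events" for v z
    using simple_functionD(2)[OF Y] simple_functionD(2)[OF XY] by auto
  have le: "Pxy (u, v) \<le> Py v" for u v
    unfolding Pxy_def Py_def by (intro finite_measure_mono ev) auto
  let ?I = "(\<lambda>\<omega>. (X \<omega>, Y \<omega>)) ` space M"
  have "\<H>(X | Y) = - (\<Sum>(x, y)\<in>?I. Pxy (x, y) * log b (Pxy (x, y) / Py y))"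
    unfolding Pxy_def Py_def
    by (intro conditional_entropy_eq simple_distributedI X Y XY measure_nonneg refl)
  with H0 have sum0: "(\<Sum>(x, y)\<in>?I. - (Pxy (x, y) * log b (Pxy (x, y) / Py y))) = 0"
    by (simp add: sum_negf case_prod_unfold)
  have term_le: "0 \<le> - (Pxy (u, v) * log b (Pxy (u, v) / Py v))" for u v
  proof (cases "Pxy (u, v) = 0")
    case False
    then have p: "Pxy (u, v) > 0" by (simp add: Pxy_def zero_less_measure_iff)
    with le[of u v] have "log b (Pxy (u, v) / Py v) \<le> 0"
      using b_gt_1 by (subst log_le_zero_cancel_iff) auto
    with p show ?thesis by (simp add: mult_nonneg_nonpos)
  qed simp
  have full: "Pxy (u, y) = Py y" if u: "Pxy (u, y) > 0" for u
  proof -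
    have "(\<lambda>\<omega>. (X \<omega>, Y \<omega>)) -` {(u, y)} \<inter> space M \<noteq> {}"
      using u unfolding Pxy_def by force
    then have "(u, y) \<in> ?I" by auto
    then have "- (Pxy (u, y) * log b (Pxy (u, y) / Py y)) = 0"
      using sum_nonneg_eq_0_iff[of ?I "\<lambda>(x, y). - (Pxy (x, y) * log b (Pxy (x, y) / Py y))"]
        sum0 term_le simple_functionD(1)[OF XY] by auto
    then have "0 \<le> log b (Pxy (u, y) / Py y)" using u by simp
    moreover have "Py y > 0" using u le[of u y] by linarith
    ultimately have "Py y \<le> Pxy (u, y)" using b_gt_1 u by (subst (asm) zero_le_log_cancel_iff) auto
    with le[of u y] show ?thesis by linarith
  qed
  have eq: "{\<omega> \<in> space M. X \<omega> = u \<and> Y \<omega> = y} = (\<lambda>\<omega>. (X \<omega>, Y \<omega>)) -` {(u, y)} \<inter> space M" for u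
    by auto
  have "Pxy (x, y) > 0" "Pxy (x', y) > 0" using pos by (simp_all add: Pxy_def eq)
  then have "Pxy (x, y) = Py y" "Pxy (x', y) = Py y" "Py y > 0"
    using full[of x] full[of x'] by simp_all
  moreover have "Pxy (x, y) + Pxy (x', y) \<le> Py y"
  proof -
    have "Pxy (x, y) + Pxy (x', y) = prob (((\<lambda>\<omega>. (X \<omega>, Y \<omega>)) -` {(x, y)} \<inter> space M)
        \<union> ((\<lambda>\<omega>. (X \<omega>, Y \<omega>)) -` {(x', y)} \<inter> space M))"
      unfolding Pxy_def using \<open>x \<noteq> x'\<close> by (intro finite_measure_Union[symmetric] ev) auto
    also have "\<dots> \<le> Py y" unfolding Py_def by (intro finite_measure_mono ev) auto
    finally show ?thesis .
  qed
  ultimately show False by linarith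
qed

section \<open>Random variables of finite range as simple functions\<close>

lemma simple_function_measurable_count_space:
  assumes "f \<in> M \<rightarrow>\<^sub>M count_space A" "finite A"
  shows "simple_function M f"
  unfolding simple_function_def
proof
  have sub: "f ` space M \<subseteq> A" using measurable_space[OF assms(1)] by auto
  then show "finite (f ` space M)" using assms(2) finite_subset by blast
  show "\<forall>v\<in>f ` space M. f -` {v} \<inter> space M \<in> sets M"
    using sub by (intro ballI measurable_sets[OF assms(1)]) auto
qed

lemma simple_function_tuple:
  assumes "finite I" "\<And>i. i \<in> I \<Longrightarrow> simple_function M (f i)"
  shows "simple_function M (\<lambda>\<omega>. \<lambda>i\<in>I. f i \<omega>)"
  using assms
proof (induction I)
  case empty
  then show ?case by (simp add: restrict_def)
next
  case (insert i I)
  have "simple_function M (\<lambda>\<omega>. (\<lambda>i\<in>I. f i \<omega>)(i := f i \<omega>))"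
    by (rule simple_function_compose2[where h = "\<lambda>g v. g(i := v)"], rule insert.IH)
      (use insert.prems in auto)
  moreover have "(\<lambda>j\<in>I. f j \<omega>)(i := f i \<omega>) = (\<lambda>j\<in>insert i I. f j \<omega>)" for \<omega>
    by auto
  ultimately show ?case by (simp only:)
qed

lemma (in finite_measure) simple_function_event:
  assumes "simple_function M f"
  shows "{\<omega> \<in> space M. f \<omega> = v} \<in> sets M"
  using simple_functionD(2)[OF assms, of "{v}"] by (simp add: vimage_def Int_def conj_commute)

lemma (in prob_space) expectation_finite_range:
  fixes g :: "'b \<Rightarrow> real"
  assumes Y: "Y \<in> M \<rightarrow>\<^sub>M count_space A" and A: "finite A"
  shows "expectation (\<lambda>\<omega>. g (Y \<omega>)) = (\<Sum>r\<in>A. prob {\<omega> \<in> space M. Y \<omega> = r} * g r)"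
proof -
  have ev: "{\<omega> \<in> space M. Y \<omega> = r} \<in> events" for r
    by (rule simple_function_event[OF simple_function_measurable_count_space[OF Y A]])
  have "expectation (\<lambda>\<omega>. g (Y \<omega>))
      = expectation (\<lambda>\<omega>. \<Sum>r\<in>A. indicator {\<omega> \<in> space M. Y \<omega> = r} \<omega> * g r)"
  proof (rule Bochner_Integration.integral_cong[OF refl])
    fix \<omega> assume \<omega>: "\<omega> \<in> space M"
    then have "Y \<omega> \<in> A" using measurable_space[OF Y] by simp
    then have "g (Y \<omega>) = (\<Sum>r\<in>A. if r = Y \<omega> then g r else 0)" using A by simp
    also have "\<dots> = (\<Sum>r\<in>A. indicator {\<omega> \<in> space M. Y \<omega> = r} \<omega> * g r)"
      using \<omega> by (intro sum.cong) auto
    finally show "g (Y \<omega>) = (\<Sum>r\<in>A. indicator {\<omega> \<in> space M. Y \<omega> = r} \<omega> * g r)" .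
  qed
  also have "\<dots> = (\<Sum>r\<in>A. prob {\<omega> \<in> space M. Y \<omega> = r} * g r)"
    using ev by (subst Bochner_Integration.integral_sum)
      (auto intro!: integrable_mult_left integrable_real_indicator simp: emeasure_eq_measure)
  finally show ?thesis .
qed

subsection \<open>Retrieval schemes\<close>

lemma words_finite: "finite A \<Longrightarrow> finite (words A k)"
  by (simp add: words_def finite_lists_length_eq)

lemma card_words: "finite A \<Longrightarrow> card (words A k) = card A ^ k"
  by (simp add: words_def card_lists_length_eq)

locale retrieval_scheme =
  fixes N n :: nat and C :: "('w, 's, 'q, 'x, 'a) ir_scheme"
  assumes N_pos: "N \<ge> 1" and scheme: "is_ir_scheme N n C"
    and finite_queries: "\<And>l. l \<in> {1..n} \<Longrightarrow> finite (query_alphabet C l)"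

sublocale retrieval_scheme \<subseteq> information_space "sample_space C" 2
proof -
  interpret prob_space "sample_space C" using scheme by (simp add: is_ir_scheme_def)
  show "information_space (sample_space C) 2" by unfold_locales simp
qed

context retrieval_scheme
begin

abbreviation "\<Omega> \<equiv> space (sample_space C)"
abbreviation "file_tuples \<equiv> {1..N} \<rightarrow>\<^sub>E file_space C"
abbreviation "query_tuples \<equiv> PiE {1..n} (query_alphabet C)"

section \<open>Finiteness, measurability and ranges of the components of a scheme\<close>

lemma finite_file_space: "finite (file_space C)"
  using scheme by (simp add: is_ir_scheme_def file_space_def words_finite)

lemma card_file_space: "card (file_space C) = card (file_symbols C) ^ file_size C"
  using scheme by (simp add: is_ir_scheme_def file_space_def card_words)

lemma stored_file_measurable:
  "m \<in> {1..N} \<Longrightarrow> stored_file C m \<in> sample_space C \<rightarrow>\<^sub>M count_space (file_space C)"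
  using scheme by (auto simp: is_ir_scheme_def indep_vars_def)

lemma requested_measurable: "requested C \<in> sample_space C \<rightarrow>\<^sub>M count_space {1..N}"
  using scheme by (simp add: is_ir_scheme_def)

lemma query_measurable:
  assumes "l \<in> {1..n}"
  shows "query C l \<in> sample_space C \<rightarrow>\<^sub>M count_space (query_alphabet C l)"
proof -
  have qf: "(\<lambda>(m, s). query_fun C l m s)
      \<in> count_space {1..N} \<Otimes>\<^sub>M strategy_space C \<rightarrow>\<^sub>M count_space (query_alphabet C l)"
    and S: "strategy C \<in> sample_space C \<rightarrow>\<^sub>M strategy_space C"
    using scheme assms by (auto simp: is_ir_scheme_def)
  from measurable_compose[OF measurable_Pair[OF requested_measurable S] qf]
  show ?thesis by (simp add: query_def[abs_def])
qed

lemma file_space_nonempty: "file_space C \<noteq> {}"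
  using measurable_space[OF stored_file_measurable[of 1]] N_pos not_empty by fastforce

lemma finite_query_tuples: "finite query_tuples"
  using finite_queries by (intro finite_PiE) auto

lemma requested_mem: "\<omega> \<in> \<Omega> \<Longrightarrow> requested C \<omega> \<in> {1..N}"
  using measurable_space[OF requested_measurable] by simp

lemma query_mem: "l \<in> {1..n} \<Longrightarrow> \<omega> \<in> \<Omega> \<Longrightarrow> query C l \<omega> \<in> query_alphabet C l"
  using measurable_space[OF query_measurable] by simp

lemma all_queries_mem: "\<omega> \<in> \<Omega> \<Longrightarrow> all_queries C n \<omega> \<in> query_tuples"
  using query_mem by (auto simp: all_queries_def)

lemma simple_stored_file: "m \<in> {1..N} \<Longrightarrow> simple_function (sample_space C) (stored_file C m)"
  by (rule simple_function_measurable_count_space[OF stored_file_measurable finite_file_space])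

lemma simple_requested: "simple_function (sample_space C) (requested C)"
  by (rule simple_function_measurable_count_space[OF requested_measurable]) simp

lemma simple_query: "l \<in> {1..n} \<Longrightarrow> simple_function (sample_space C) (query C l)"
  by (rule simple_function_measurable_count_space[OF query_measurable finite_queries])

lemma simple_all_files: "simple_function (sample_space C) (all_files C N)"
  unfolding all_files_def[abs_def] by (intro simple_function_tuple simple_stored_file) auto

lemma simple_all_queries: "simple_function (sample_space C) (all_queries C n)"
  unfolding all_queries_def[abs_def] by (intro simple_function_tuple simple_query) auto

lemma simple_all_answers: "simple_function (sample_space C) (all_answers C N n)"
  unfolding all_answers_def[abs_def] answer_def[abs_def]
  by (intro simple_function_tuple simple_function_compose2[where h = "answer_fun C _"]
      simple_query simple_all_files) auto

lemma simple_requested_file: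
  "simple_function (sample_space C) (\<lambda>\<omega>. stored_file C (requested C \<omega>) \<omega>)"
proof -
  \<comment> \<open>Evaluating the tuple of files at the request combines two simple functions, and
    it gives the requested file because requests lie in \<open>{1..N}\<close>.\<close>
  have "simple_function (sample_space C) (\<lambda>\<omega>. all_files C N \<omega> (requested C \<omega>))"
    by (rule simple_function_compose2[where h = "\<lambda>g m. g m", OF simple_all_files simple_requested])
  also have "?this \<longleftrightarrow> ?thesis"
    by (rule simple_function_cong) (use requested_mem in \<open>auto simp: all_files_def\<close>)
  finally show ?thesis .
qed

section \<open>Events of positive probability and decoding\<close>

lemma prob_requested:
  assumes "m \<in> {1..N}"
  shows "prob {\<omega> \<in> \<Omega>. requested C \<omega> = m} = 1 / N"
proof -
  have "distr (sample_space C) (count_space {1..N}) (requested C) = uniform_count_measure {1..N}"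
    using scheme by (simp add: is_ir_scheme_def)
  then have "measure (distr (sample_space C) (count_space {1..N}) (requested C)) {m} = 1 / N"
    using assms by (simp add: measure_uniform_count_measure)
  moreover have "measure (distr (sample_space C) (count_space {1..N}) (requested C)) {m}
      = prob (requested C -` {m} \<inter> \<Omega>)"
    using assms by (intro measure_distr requested_measurable) auto
  ultimately show ?thesis by (simp add: vimage_def Int_def conj_commute)
qed

text \<open>By independence the probability is a product of factors
  \<open>1 / card (file_space C)\<close>.\<close>

lemma prob_all_files_pos:
  assumes x: "x \<in> file_tuples"
  shows "prob {\<omega> \<in> \<Omega>. all_files C N \<omega> = x} > 0"
proof -
  have "prob (stored_file C m -` {x m} \<inter> \<Omega>) > 0" if m: "m \<in> {1..N}" for m
  proof -
    have xm: "x m \<in> file_space C" using x m by auto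
    have "distr (sample_space C) (count_space (file_space C)) (stored_file C m)
        = uniform_count_measure (file_space C)"
      using scheme m by (auto simp: is_ir_scheme_def)
    then have "measure (distr (sample_space C) (count_space (file_space C)) (stored_file C m)) {x m}
        = 1 / card (file_space C)"
      using xm by (simp add: measure_uniform_count_measure finite_file_space)
    then have "prob (stored_file C m -` {x m} \<inter> \<Omega>) = 1 / card (file_space C)"
      using xm by (simp add: measure_distr[OF stored_file_measurable[OF m]])
    then show ?thesis
      using finite_file_space file_space_nonempty by (simp add: card_gt_0_iff)
  qed
  then have "0 < (\<Prod>m\<in>{1..N}. prob (stored_file C m -` {x m} \<inter> \<Omega>))"
    by (intro prod_pos) auto
  also have "\<dots> = prob (\<Inter>m\<in>{1..N}. stored_file C m -` {x m} \<inter> \<Omega>)"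
    using scheme N_pos x
    by (intro indep_varsD_finite[symmetric, of "\<lambda>_. count_space (file_space C)"])
      (auto simp: is_ir_scheme_def)
  also have "(\<Inter>m\<in>{1..N}. stored_file C m -` {x m} \<inter> \<Omega>) = {\<omega> \<in> \<Omega>. all_files C N \<omega> = x}"
  proof -
    have "all_files C N \<omega> = x \<longleftrightarrow> (\<forall>m\<in>{1..N}. stored_file C m \<omega> = x m)" for \<omega>
      using x unfolding all_files_def by (auto simp: fun_eq_iff PiE_iff extensional_def)
    \<comment> \<open>A nonempty index set keeps the intersection inside \<Omega>.\<close>
    moreover have "1 \<in> {1..N}" using N_pos by simp
    ultimately show ?thesis by blast
  qed
  finally show ?thesis .
qed

text \<open>Vanishing mutual information factorises the probability into two positive ones. Hence
  all file tuples can be compared under one fixed query tuple and request.\<close>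

lemma prob_files_queries_pos:
  assumes x: "x \<in> file_tuples" and pos: "prob {\<omega> \<in> \<Omega>. requested C \<omega> = m \<and> all_queries C n \<omega> = k} > 0"
  shows "prob {\<omega> \<in> \<Omega>. all_files C N \<omega> = x \<and> (all_queries C n \<omega>, requested C \<omega>) = (k, m)} > 0"
proof -
  let ?Y = "\<lambda>\<omega>. (all_queries C n \<omega>, requested C \<omega>)"
  have sY: "simple_function (sample_space C) ?Y"
    by (rule simple_function_Pair[OF simple_all_queries simple_requested])
  have X: "prob {\<omega> \<in> \<Omega>. all_files C N \<omega> = x} > 0" by (rule prob_all_files_pos[OF x])
  have eq: "{\<omega> \<in> \<Omega>. ?Y \<omega> = (k, m)} = {\<omega> \<in> \<Omega>. requested C \<omega> = m \<and> all_queries C n \<omega> = k}"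
    by auto
  have Y: "prob {\<omega> \<in> \<Omega>. ?Y \<omega> = (k, m)} > 0" unfolding eq by (rule pos)
  \<comment> \<open>The factorisation is available at attained values; positive probability
    guarantees that they are attained.\<close>
  have nonempty: "v \<in> f ` \<Omega>" if "prob {\<omega> \<in> \<Omega>. f \<omega> = v} > 0" for f :: "'w \<Rightarrow> 'z" and v
  proof -
    have "{\<omega> \<in> \<Omega>. f \<omega> = v} \<noteq> {}" using that by force
    then show ?thesis by auto
  qed
  have "mutual_information 2 (count_space (all_files C N ` \<Omega>)) (count_space (?Y ` \<Omega>)) (all_files C N) ?Y = 0"
    using scheme by (simp add: is_ir_scheme_def mutual_info_def)
  from prob_mult_of_mutual_information_0[OF simple_all_files sY this nonempty[OF X] nonempty[OF Y]]
  show ?thesis using X Y by simp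
qed

text \<open>Equal answers for \<open>x\<close> and \<open>y\<close> make both values of the
  requested file occur with positive probability beside one and the same observation, so zero
  conditional entropy identifies them.\<close>

lemma decoding:
  assumes m: "m \<in> {1..N}" and pos: "prob {\<omega> \<in> \<Omega>. requested C \<omega> = m \<and> all_queries C n \<omega> = k} > 0"
    and xy: "x \<in> file_tuples" "y \<in> file_tuples"
    and eq: "\<And>l. l \<in> {1..n} \<Longrightarrow> answer_fun C l (k l) x = answer_fun C l (k l) y"
  shows "x m = y m"
proof -
  let ?X = "\<lambda>\<omega>. stored_file C (requested C \<omega>) \<omega>"
  let ?Y = "\<lambda>\<omega>. (all_answers C N n \<omega>, all_queries C n \<omega>, requested C \<omega>)"
  define a where "a = (\<lambda>l\<in>{1..n}. answer_fun C l (k l) x)"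
  have sY: "simple_function (sample_space C) ?Y"
    by (intro simple_function_Pair simple_all_answers simple_all_queries simple_requested)
  have H0: "conditional_entropy 2 (count_space (?X ` \<Omega>)) (count_space (?Y ` \<Omega>)) ?X ?Y = 0"
    using scheme by (simp add: is_ir_scheme_def cond_entropy_def)
  have *: "prob {\<omega> \<in> \<Omega>. ?X \<omega> = z m \<and> ?Y \<omega> = (a, k, m)} > 0"
    if z: "z \<in> file_tuples" "\<And>l. l \<in> {1..n} \<Longrightarrow> answer_fun C l (k l) z = answer_fun C l (k l) x" for z
  proof -
    have "{\<omega> \<in> \<Omega>. all_files C N \<omega> = z \<and> (all_queries C n \<omega>, requested C \<omega>) = (k, m)}
        \<subseteq> {\<omega> \<in> \<Omega>. ?X \<omega> = z m \<and> ?Y \<omega> = (a, k, m)}"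
    proof
      fix \<omega> assume "\<omega> \<in> {\<omega> \<in> \<Omega>. all_files C N \<omega> = z \<and> (all_queries C n \<omega>, requested C \<omega>) = (k, m)}"
      then have \<omega>: "\<omega> \<in> \<Omega>" "all_files C N \<omega> = z" "all_queries C n \<omega> = k" "requested C \<omega> = m"
        by auto
      have "query C l \<omega> = k l" if "l \<in> {1..n}" for l
        using that \<omega>(3) by (auto simp: all_queries_def)
      then have "all_answers C N n \<omega> = a"
        using z(2) \<omega>(2) by (auto simp: all_answers_def a_def answer_def intro!: restrict_ext)
      moreover have "stored_file C m \<omega> = z m" using \<omega>(2) m by (auto simp: all_files_def)
      ultimately show "\<omega> \<in> {\<omega> \<in> \<Omega>. ?X \<omega> = z m \<and> ?Y \<omega> = (a, k, m)}" using \<omega> by simp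
    qed
    moreover have "{\<omega> \<in> \<Omega>. ?X \<omega> = z m \<and> ?Y \<omega> = (a, k, m)} \<in> events"
      using simple_function_event[OF simple_function_Pair[OF simple_requested_file sY], of "(z m, a, k, m)"]
      by simp
    ultimately show ?thesis
      using prob_files_queries_pos[OF z(1) pos] finite_measure_mono by (meson less_le_trans)
  qed
  show ?thesis
    by (rule determined_of_conditional_entropy_0[OF simple_requested_file sY H0 *[OF xy(1)] *[OF xy(2)]])
       (simp_all add: eq)
qed

text \<open>The conditional probability of \<open>k\<close> given request \<open>m\<close>: as
  requests are uniform, conditioning is multiplication by \<open>N\<close>.\<close>

definition query_weight :: "nat \<Rightarrow> (nat \<Rightarrow> 'q) \<Rightarrow> real" where
  "query_weight m k = N * prob {\<omega> \<in> \<Omega>. requested C \<omega> = m \<and> all_queries C n \<omega> = k}"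

section \<open>Query laws, leakage and download cost\<close>

lemma requested_queries_event: "{\<omega> \<in> \<Omega>. requested C \<omega> = m \<and> all_queries C n \<omega> = k} \<in> events"
  using simple_function_event[OF simple_function_Pair[OF simple_requested simple_all_queries], of "(m, k)"]
  by simp

lemma requested_query_event:
  "l \<in> {1..n} \<Longrightarrow> {\<omega> \<in> \<Omega>. query C l \<omega> = r \<and> requested C \<omega> = m} \<in> events"
  using simple_function_event[OF simple_function_Pair[OF simple_query simple_requested], of l "(r, m)"]
  by simp

lemma sum_query_weight:
  assumes m: "m \<in> {1..N}"
  shows "(\<Sum>k\<in>query_tuples. query_weight m k) = 1"
proof -
  have "prob {\<omega> \<in> \<Omega>. requested C \<omega> = m}
      = (\<Sum>k\<in>query_tuples. prob {\<omega> \<in> \<Omega>. requested C \<omega> = m \<and> all_queries C n \<omega> = k})"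
    using all_queries_mem
    by (intro prob_sum finite_query_tuples requested_queries_event simple_function_event[OF simple_requested] AE_I2)
      auto
  then show ?thesis
    unfolding query_weight_def sum_distrib_left[symmetric] prob_requested[OF m]
    using N_pos by (metis nonzero_eq_divide_eq mult.commute of_nat_0_eq_iff not_one_le_zero)
qed

lemma query_marginal:
  assumes l: "l \<in> {1..n}"
  shows "(\<Sum>k | k \<in> query_tuples \<and> k l = r. query_weight m k)
    = N * prob {\<omega> \<in> \<Omega>. query C l \<omega> = r \<and> requested C \<omega> = m}"
proof -
  have "all_queries C n \<omega> l = query C l \<omega>" for \<omega> using l by (simp add: all_queries_def)
  then have "prob {\<omega> \<in> \<Omega>. query C l \<omega> = r \<and> requested C \<omega> = m}
      = (\<Sum>k | k \<in> query_tuples \<and> k l = r. prob {\<omega> \<in> \<Omega>. requested C \<omega> = m \<and> all_queries C n \<omega> = k})"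
    using all_queries_mem finite_query_tuples
    by (intro prob_sum requested_queries_event requested_query_event[OF l] AE_I2) auto
  then show ?thesis unfolding query_weight_def sum_distrib_left[symmetric] by simp
qed

lemma sum_requested_query:
  assumes l: "l \<in> {1..n}"
  shows "(\<Sum>m=1..N. prob {\<omega> \<in> \<Omega>. query C l \<omega> = r \<and> requested C \<omega> = m})
    = prob {\<omega> \<in> \<Omega>. query C l \<omega> = r}"
  using requested_mem
  by (intro prob_sum[symmetric] requested_query_event[OF l] simple_function_event[OF simple_query[OF l]] AE_I2)
    auto

text \<open>The conditional probabilities in the leakage are the marginals of
  \<open>query_weight\<close>; exponentiating the bound removes the logarithm.\<close>

lemma leakage_sum_le:
  assumes l: "l \<in> {1..n}" and leak: "maximal_leakage N n C \<le> \<rho>"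
  shows "(\<Sum>r\<in>query_alphabet C l. MAX m\<in>{1..N}. \<Sum>k | k \<in> query_tuples \<and> k l = r. query_weight m k) \<le> 2 powr \<rho>"
proof -
  let ?f = "\<lambda>l. \<Sum>q\<in>query_alphabet C l. MAX m\<in>{1..N}.
    \<P>(\<omega> in sample_space C. query C l \<omega> = q \<bar> requested C \<omega> = m)"
  have "\<P>(\<omega> in sample_space C. query C l \<omega> = r \<bar> requested C \<omega> = m)
      = (\<Sum>k | k \<in> query_tuples \<and> k l = r. query_weight m k)" if "m \<in> {1..N}" for r m
    unfolding query_marginal[OF l] cond_prob_def prob_requested[OF that] by simp
  then have "?f l = (\<Sum>r\<in>query_alphabet C l. MAX m\<in>{1..N}. \<Sum>k | k \<in> query_tuples \<and> k l = r. query_weight m k)"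
    by (intro sum.cong refl arg_cong[of _ _ Max] image_cong) auto
  moreover have "?f l \<le> 2 powr \<rho>"
  \<comment> \<open>The logarithm of a nonpositive number carries no information; in that case
    nonnegativity of \<open>2 powr \<rho>\<close> suffices.\<close>
  proof (cases "?f l > 0")
    case True
    have "log 2 (?f l) \<le> maximal_leakage N n C"
      unfolding maximal_leakage_def using l by (intro Max_ge) auto
    with leak have "log 2 (?f l) \<le> \<rho>" by linarith
    with True show ?thesis by (simp add: log_le_iff)
  next
    case False
    then show ?thesis by (meson linorder_not_less order_trans powr_ge_zero)
  qed
  ultimately show ?thesis by simp
qed

text \<open>Total probability over the \<open>N\<close> equally likely requests turns the
  conditional query laws into the unconditional one of the expected length.\<close>

lemma download_cost_eq:
  "N * download_cost n C = (\<Sum>m=1..N. \<Sum>l=1..n. \<Sum>r\<in>query_alphabet C l.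
     (\<Sum>k | k \<in> query_tuples \<and> k l = r. query_weight m k)
       * (answer_length C l r * log 2 (card (answer_symbols C))))"
proof -
  let ?p = "\<lambda>l r m. prob {\<omega> \<in> \<Omega>. query C l \<omega> = r \<and> requested C \<omega> = m}"
  let ?A = "log 2 (card (answer_symbols C))"
  have "(\<Sum>m=1..N. \<Sum>l=1..n. \<Sum>r\<in>query_alphabet C l.
     (\<Sum>k | k \<in> query_tuples \<and> k l = r. query_weight m k) * (answer_length C l r * ?A))
    = (\<Sum>m=1..N. \<Sum>l=1..n. \<Sum>r\<in>query_alphabet C l. ?p l r m * (N * answer_length C l r * ?A))"
    by (intro sum.cong refl) (subst query_marginal, simp, simp add: mult_ac)
  also have "\<dots> = (\<Sum>l=1..n. \<Sum>m=1..N. \<Sum>r\<in>query_alphabet C l. ?p l r m * (N * answer_length C l r * ?A))"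
    by (rule sum.swap)
  also have "\<dots> = (\<Sum>l=1..n. \<Sum>r\<in>query_alphabet C l. \<Sum>m=1..N. ?p l r m * (N * answer_length C l r * ?A))"
    by (rule sum.cong[OF refl], rule sum.swap)
  also have "\<dots> = (\<Sum>l=1..n. \<Sum>r\<in>query_alphabet C l.
      prob {\<omega> \<in> \<Omega>. query C l \<omega> = r} * (N * answer_length C l r * ?A))"
    unfolding sum_distrib_right[symmetric] by (intro sum.cong refl arg_cong2[of _ _ _ _ "(*)"] sum_requested_query)
  also have "\<dots> = (\<Sum>l=1..n. N * ?A * (\<Sum>r\<in>query_alphabet C l.
      prob {\<omega> \<in> \<Omega>. query C l \<omega> = r} * answer_length C l r))"
    by (simp add: sum_distrib_left mult_ac)
  also have "\<dots> = (\<Sum>l=1..n. N * ?A * expectation (\<lambda>\<omega>. real (answer_length C l (query C l \<omega>))))"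
    by (intro sum.cong refl)
      (simp add: expectation_finite_range[OF query_measurable finite_queries,
          where g = "\<lambda>r. real (answer_length C _ r)"])
  also have "\<dots> = N * download_cost n C"
    by (simp add: download_cost_def sum_distrib_left mult_ac)
  finally show ?thesis ..
qed

lemma log_card_answers_le:
  assumes "l \<in> {1..n}" "r \<in> query_alphabet C l"
  shows "log 2 (card (answer_fun C l r ` file_tuples)) \<le> answer_length C l r * log 2 (card (answer_symbols C))"
proof -
  let ?A = "answer_symbols C" and ?k = "answer_length C l r"
  have A: "finite ?A" using scheme by (simp add: is_ir_scheme_def)
  have "answer_fun C l r ` file_tuples \<subseteq> words ?A ?k"
    using scheme assms by (auto simp: is_ir_scheme_def)
  then have le: "card (answer_fun C l r ` file_tuples) \<le> card ?A ^ ?k"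
    using card_mono[OF words_finite[OF A]] by (simp add: card_words[OF A])
  have "finite file_tuples" "file_tuples \<noteq> {}"
    using finite_file_space file_space_nonempty by (auto intro!: finite_PiE simp: PiE_eq_empty_iff)
  then have pos: "card (answer_fun C l r ` file_tuples) > 0" by (simp add: card_gt_0_iff)
  have "log 2 (card (answer_fun C l r ` file_tuples)) \<le> log 2 (card ?A ^ ?k)"
    using le pos by (intro log_mono) (auto simp flip: of_nat_power)
  \<comment> \<open>With no answer symbols, the positive number of answers forces
    \<open>?k = 0\<close>, and both sides are 0.\<close>
  also have "\<dots> = ?k * log 2 (card ?A)"
    using le pos by (cases "card ?A = 0") (auto simp: log_nat_power power_0_left split: if_splits)
  finally show ?thesis .
qed

text \<open>The recursion bounds the conditional cost for every request; summing over all requests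
  recovers the download cost.\<close>

lemma download_cost_ge:
  assumes n: "n \<ge> 1"
    and ans: "\<And>l. l \<in> {1..n} \<Longrightarrow> finite (answer_alphabet C l)
      \<and> card (answer_alphabet C l) \<le> card (file_symbols C) ^ file_size C"
    and leak: "maximal_leakage N n C \<le> \<rho>"
  shows "log 2 (card (file_space C)) * leakage_bracket n (2 powr \<rho>) (N - 1) \<le> download_cost n C"
proof -
  \<comment> \<open>A whole file is one element of \<open>V\<close>, so \<open>L\<close> is the
    entropy of a file, and the bound on the answer alphabets becomes
    \<open>answers_le\<close>.\<close>
  interpret weighted_retrieval N n "file_space C" "query_alphabet C" query_weight "answer_fun C" "2 powr \<rho>"
  proof
    show "card (answer_fun C l r ` file_tuples) \<le> card (file_space C)"
      if "l \<in> {1..n}" "r \<in> query_alphabet C l" for l r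
    proof -
      have "answer_fun C l r ` file_tuples \<subseteq> answer_alphabet C l"
        using scheme that by (auto simp: is_ir_scheme_def)
      then have "card (answer_fun C l r ` file_tuples) \<le> card (answer_alphabet C l)"
        using ans[OF that(1)] card_mono by blast
      then show ?thesis using ans[OF that(1)] by (simp add: card_file_space)
    qed
    show "x m = y m" if "m \<in> {1..N}" "query_weight m k > 0" "x \<in> file_tuples" "y \<in> file_tuples"
      "\<And>l. l \<in> {1..n} \<Longrightarrow> answer_fun C l (k l) x = answer_fun C l (k l) y" for m k x y
      by (rule decoding[OF that(1) _ that(3-5)])
        (use that(2) in \<open>auto simp: query_weight_def zero_less_mult_iff\<close>)
  qed (use n finite_file_space file_space_nonempty finite_queries sum_query_weight leakage_sum_le[OF _ leak]
      in \<open>auto simp: query_weight_def\<close>)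
  have "N * (log 2 (card (file_space C)) * leakage_bracket n (2 powr \<rho>) (N - 1))
      = (\<Sum>m=1..N. log 2 (card (file_space C)) * leakage_bracket n (2 powr \<rho>) (N - 1))"
    by simp
  also have "\<dots> \<le> (\<Sum>m=1..N. \<Sum>l=1..n. \<Sum>r\<in>query_alphabet C l.
      marginal l m r * log 2 (card (answer_fun C l r ` file_tuples)))"
    by (rule sum_mono) (rule log_answers_ge)
  also have "\<dots> \<le> (\<Sum>m=1..N. \<Sum>l=1..n. \<Sum>r\<in>query_alphabet C l.
      marginal l m r * (answer_length C l r * log 2 (card (answer_symbols C))))"
    by (intro sum_mono mult_left_mono marginal_nonneg log_card_answers_le)
  also have "\<dots> = N * download_cost n C"
    unfolding download_cost_eq marginal_def ..
  finally show ?thesis using N_pos by (simp add: mult_le_cancel_left)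
qed

end

section \<open>From the download cost to the maximum rate\<close>

theorem theorem10:
  fixes N n \<alpha> :: nat and \<rho> :: real
    and T :: "('w, 's, 'q, 'x, 'a) ir_scheme itself"
  assumes "N \<ge> 1" and "n \<ge> 1" and "\<alpha> \<ge> 1"
    and bracket_pos: "1 + (\<Sum>m=1..N-1. 1 / real n ^ m)
           - (\<Sum>m=1..N-1. (2 powr \<rho> - 1) / real n ^ (m - 1)) > 0"
  shows "wpir_max_rate T N n \<alpha> \<rho>
    \<le> ereal (inverse (1 + (\<Sum>m=1..N-1. 1 / real n ^ m)
                - (\<Sum>m=1..N-1. (2 powr \<rho> - 1) / real n ^ (m - 1))))"
proof -
  let ?B = "leakage_bracket n (2 powr \<rho>) (N - 1)"
  have B: "?B > 0" using bracket_pos by (simp add: leakage_bracket_def)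
  have "rate n C \<le> inverse ?B"
    if C: "is_ir_scheme N n C"
      "\<forall>l\<in>{1..n}. finite (query_alphabet C l) \<and> card (query_alphabet C l) \<le> \<alpha>"
      "\<forall>l\<in>{1..n}. finite (answer_alphabet C l) \<and>
         card (answer_alphabet C l) \<le> card (file_symbols C) ^ file_size C"
      "maximal_leakage N n C \<le> \<rho>" for C :: "('w, 's, 'q, 'x, 'a) ir_scheme"
  proof -
    interpret retrieval_scheme N n C using assms(1) C by unfold_locales auto
    let ?L = "real (file_size C) * log 2 (card (file_symbols C))"
    have "card (file_space C) > 0"
      using finite_file_space file_space_nonempty by (simp add: card_gt_0_iff)
    then have L: "log 2 (card (file_space C)) \<ge> 0" by (simp add: Suc_le_eq)
    \<comment> \<open>For file size \<open>0\<close> the symbol set may be empty; both sides are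
      then 0.\<close>
    have L_eq: "log 2 (card (file_space C)) = ?L"
      using \<open>card (file_space C) > 0\<close>
      unfolding card_file_space by (cases "file_size C = 0") (auto simp: log_nat_power)
    then have D: "?L * ?B \<le> download_cost n C"
      using download_cost_ge[OF assms(2) _ C(4)] C(3) by (simp flip: L_eq)
    show ?thesis
    proof (cases "download_cost n C > 0")
      case True
      then show ?thesis using D B by (simp add: rate_def field_simps)
    next
      case False
      \<comment> \<open>The signs alone make the rate nonpositive; for download cost 0 the quotient
        is 0 by the convention for division.\<close>
      have "?L \<ge> 0" using L L_eq by simp
      then have "rate n C \<le> 0"
        using False by (simp add: rate_def divide_nonneg_nonpos)
      also have "0 \<le> inverse ?B" using B by simp
      finally show ?thesis .
    qed
  qed
  then show ?thesis
    unfolding wpir_max_rate_def by (intro SUP_least) (simp add: leakage_bracket_def)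
qed

end
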